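(* Let $k \ge 2$ be an integer. Suppose that $G$ is an $n$-vertex graph containing no cycle of length $3,5,\ldots,2k+1$ (i.e., no odd cycle of length at most $2k+1$) as a subgraph, and satisfying $$\delta(G) > \min\left\{ \frac{n}{k+1} - \frac{\Delta(G)}{2k+2},~ \frac{n-1-\Delta(G)}{k} \right\}.$$ Then $G$ is bipartite.
   Context: All graphs are finite and simple. $\delta(G)$ and $\Delta(G)$ denote the minimum and maximum degree of $G$. *)

theory Defs
  imports Complex_Main "Graph_Theory.Graph_Theory"
begin

text \<open>
  A finite simple graph is a \<^locale>\<open>pair_graph\<close>: a finite vertex set with a symmetric,
  irreflexive set of arcs. An undirected edge \<open>uv\<close> is the pair of arcs \<open>(u, v)\<close>, \<open>(v, u)\<close>,
  so the degree of a vertex is its out-degree.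
\<close>

definition min_degree :: "'a pair_pre_digraph \<Rightarrow> nat" where
  "min_degree G = Min (out_degree (with_proj G) ` pverts G)"

definition max_degree :: "'a pair_pre_digraph \<Rightarrow> nat" where
  "max_degree G = Max (out_degree (with_proj G) ` pverts G)"

text \<open>
  For \<open>l \<ge> 3\<close> the directed cycles of length \<open>l\<close> are exactly the oriented, rooted copies of the
  undirected cycle \<open>C\<^sub>l\<close>. (For \<open>l = 2\<close> this would fail: \<open>(u, v), (v, u)\<close> is a directed cycle.)
\<close>

definition has_cycle_of_length :: "'a pair_pre_digraph \<Rightarrow> nat \<Rightarrow> bool" where
  "has_cycle_of_length G l \<longleftrightarrow> (\<exists>p. pre_digraph.cycle (with_proj G) p \<and> length p = l)"

definition bipartite :: "'a pair_pre_digraph \<Rightarrow> bool" where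
  "bipartite G \<longleftrightarrow>
    (\<exists>A B. A \<union> B = pverts G \<and> A \<inter> B = {} \<and>
      (\<forall>(u, v) \<in> parcs G. (u \<in> A \<and> v \<in> B) \<or> (u \<in> B \<and> v \<in> A)))"

end

theory Submission
  imports Defs
begin

text \<open>
  Suppose \<open>G\<close> is not bipartite and let \<open>v\<close> be a vertex of maximum degree. If \<open>v\<close> lies on an odd
  closed walk, let \<open>w\<^sub>0 = v, w\<^sub>1, \<dots>\<close> be a shortest one; it has length at least \<open>2k + 3\<close>. For
  \<open>i < j \<le> 2k + 2\<close>, a common neighbour of \<open>w\<^sub>i\<close> and \<open>w\<^sub>j\<close> either shortens the walk or closes up a short
  odd walk, unless \<open>j - i\<close> is \<open>2\<close> or \<open>2k + 1\<close>. Hence every vertex is adjacent to at most two of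
  \<open>w\<^sub>0, \<dots>, w\<^bsub>2k+2\<^esub>\<close>, and double counting gives \<open>\<Delta> + (2k + 2) \<delta> \<le> 2n\<close>. Moreover
  \<open>w\<^sub>0, w\<^sub>1, w\<^sub>4, w\<^sub>5, w\<^sub>8, \<dots>\<close> (with \<open>k + 1\<close> terms) have pairwise disjoint neighbourhoods which miss a
  further vertex of the walk, so \<open>\<Delta> + k \<delta> + 1 \<le> n\<close>. If \<open>v\<close> lies on no odd closed walk, the same
  counting applies to a walk elsewhere, whose neighbourhoods do not meet that of \<open>v\<close>.
\<close>

section \<open>Walks, bipartiteness and short odd cycles\<close>

lemma walk_segment:
  assumes "\<forall>i<L. (f i, f (Suc i)) \<in> E" "i \<le> j" "j \<le> L"
  shows "(f i, f j) \<in> E ^^ (j - i)"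
  unfolding relpow_fun_conv
  using assms by (intro exI[of _ "\<lambda>t. f (i + t)"]) auto

lemma relpow_symD:
  assumes "sym E" "(x, y) \<in> E ^^ n"
  shows "(y, x) \<in> E ^^ n"
  using assms(2)
proof (induction n arbitrary: y)
  case (Suc n)
  then show ?case
    using assms(1) by (meson relpow_Suc_E relpow_Suc_I2 symD)
qed simp

text \<open>If all closed walks are even, the parity of a walk from a vertex to a fixed
  representative of its component is well defined, and it 2-colours the graph.\<close>

lemma odd_closed_walk_if_not_bipartite:
  assumes "pair_graph G" "\<not> bipartite G"
  obtains x l where "odd l" "(x, x) \<in> parcs G ^^ l"
proof -
  interpret pair_graph G by fact
  let ?E = "parcs G"
  have sy: "sym ?E"
    using pair_sym_arcs by (auto simp: symmetric_def)
  have False if no: "\<And>x l. odd l \<Longrightarrow> (x, x) \<notin> ?E ^^ l"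
  proof -
    \<comment> \<open>Adjacent vertices reach the same vertices, so \<open>SOME\<close> receives the
      same predicate and \<open>r\<close> is constant along edges.\<close>
    define r where "r x = (SOME y. \<exists>n. (x, y) \<in> ?E ^^ n)" for x
    have r: "\<exists>n. (x, r x) \<in> ?E ^^ n" for x
      unfolding r_def by (rule someI[of _ x]) (auto intro: exI[of _ 0])
    have r_eq: "r u = r v" if "(u, v) \<in> ?E" for u v
    proof -
      have "(\<exists>n. (u, y) \<in> ?E ^^ n) \<longleftrightarrow> (\<exists>n. (v, y) \<in> ?E ^^ n)" for y
        using that sy by (meson relpow_Suc_I2 symD)
      then show ?thesis by (simp add: r_def)
    qed
    have parity: "odd (n + m)" if "(u, v) \<in> ?E" "(u, r u) \<in> ?E ^^ n" "(v, r v) \<in> ?E ^^ m" for u v n m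
    proof -
      \<comment> \<open>The closed walk runs from \<open>u\<close> to \<open>r u\<close> in
        \<open>n\<close> steps, on to \<open>v\<close> in \<open>m\<close> steps, and back to
        \<open>u\<close> along the edge.\<close>
      have "(r u, v) \<in> ?E ^^ m"
        using that r_eq[OF that(1)] relpow_symD[OF sy] by metis
      then have "(u, u) \<in> ?E ^^ Suc (n + m)"
        using that(1,2) sy by (meson relpow_trans relpow_Suc_I symD)
      then show ?thesis
        using no[of "Suc (n + m)" u] by auto
    qed
    define A where "A = {x \<in> pverts G. \<exists>n. even n \<and> (x, r x) \<in> ?E ^^ n}"
    have "bipartite G"
      unfolding bipartite_def
    proof (intro exI conjI)
      show "A \<union> (pverts G - A) = pverts G" "A \<inter> (pverts G - A) = {}"
        by (auto simp: A_def)
      show "\<forall>(u, v)\<in>?E. u \<in> A \<and> v \<in> pverts G - A \<or> u \<in> pverts G - A \<and> v \<in> A"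
      proof clarify
        fix u v assume uv: "(u, v) \<in> ?E" "\<not> (u \<in> pverts G - A \<and> v \<in> A)"
        obtain n m where nm: "(u, r u) \<in> ?E ^^ n" "(v, r v) \<in> ?E ^^ m"
          using r by meson
        have V: "u \<in> pverts G" "v \<in> pverts G"
          using uv(1) in_arcsD1 in_arcsD2 by auto
        have "\<not> (u \<in> A \<and> v \<in> A)"
          using parity[OF uv(1)] unfolding A_def by fastforce
        moreover have "u \<in> A \<or> v \<in> A"
          using parity[OF uv(1) nm] nm V unfolding A_def by auto
        ultimately show "u \<in> A \<and> v \<in> pverts G - A"
          using uv V by auto
      qed
    qed
    then show False using assms by simp
  qed
  then show thesis using that by blast
qed

lemma cycle_of_walk:
  assumes "pair_graph G" "l > 0" "\<forall>i<l. (f i, f (Suc i)) \<in> parcs G" "f l = f 0" "inj_on f {0..<l}"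
  shows "has_cycle_of_length G l"
proof -
  interpret pair_graph G by fact
  define p where "p = map (\<lambda>i. (f i, f (Suc i))) [0..<l]"
  \<comment> \<open>The start index \<open>a\<close> is arbitrary because the recursion on arc lists
    peels off the first arc.\<close>
  have gen: "pcas (f a) (map (\<lambda>i. (f i, f (Suc i))) [a..<a+n]) (f (a + n)) \<and>
      pawalk_verts (f a) (map (\<lambda>i. (f i, f (Suc i))) [a..<a+n]) = map f [a..<Suc (a + n)]" for a n
  proof (induction n arbitrary: a)
    case (Suc n)
    have "[a..<a + Suc n] = a # [Suc a..<Suc a + n]" "[a..<Suc (a + Suc n)] = a # [Suc a..<Suc (Suc a + n)]"
      by (simp_all add: upt_conv_Cons)
    then show ?case using Suc.IH[of "Suc a"] by simp
  qed simp
  have cas: "pcas (f 0) p (f 0)" and verts: "pawalk_verts (f 0) p = map f [0..<Suc l]"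
    using gen[of 0 l] assms(4) by (simp_all add: p_def)
  have "(f 0, f 1) \<in> parcs G"
    using assms(2,3) by force
  then have "f 0 \<in> pverts G"
    using in_arcsD1 by auto
  then have walk: "awalk (f 0) p (f 0)"
    using cas assms(3) by (auto simp: awalk_def p_def)
  have "[0..<Suc l] = 0 # [Suc 0..<l] @ [l]"
    using assms(2) by (simp add: upt_conv_Cons)
  then have tl: "tl (map f [0..<Suc l]) = map f [Suc 0..<l] @ [f 0]"
    using assms(4) by simp
  \<comment> \<open>\<open>cycle\<close> wants the vertex list to be distinct without its head, so
    \<open>f 0\<close> counts only as the final vertex.\<close>
  have "inj_on f {Suc 0..<l}" "f 0 \<notin> f ` {Suc 0..<l}"
    using assms(5,2) by (fastforce simp: inj_on_def)+
  then have "distinct (tl (pawalk_verts (f 0) p))"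
    unfolding verts tl by (auto simp: distinct_map)
  then have "cycle p"
    unfolding cycle_def using walk assms(2) by (auto simp: p_def)
  then show ?thesis
    unfolding has_cycle_of_length_def by (auto simp: p_def)
qed

text \<open>A shortest odd closed walk in the whole graph is a cycle: a repeated vertex splits it
  into two shorter closed walks, one of which is odd. Length 1 would be a loop.\<close>

lemma no_short_odd_closed_walk:
  assumes "pair_graph G"
    and "\<forall>l \<in> {3..2 * k + 1}. odd l \<longrightarrow> \<not> has_cycle_of_length G l"
    and "odd l" "l \<le> 2 * k + 1"
  shows "(x, x) \<notin> parcs G ^^ l"
proof
  interpret pair_graph G by fact
  let ?E = "parcs G"
  assume "(x, x) \<in> ?E ^^ l"
  define P where "P m \<longleftrightarrow> odd m \<and> (\<exists>y. (y, y) \<in> ?E ^^ m)" for m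
  define m where "m = (LEAST m. P m)"
  have "P l" using \<open>(x, x) \<in> ?E ^^ l\<close> assms(3) by (auto simp: P_def)
  then have "P m" "m \<le> l" and least: "\<And>m'. P m' \<Longrightarrow> m \<le> m'"
    unfolding m_def by (auto intro: LeastI Least_le)
  then obtain f where f: "f m = f 0" "\<forall>i<m. (f i, f (Suc i)) \<in> ?E" and "odd m"
    unfolding P_def relpow_fun_conv by auto
  have False if "i < j" "j < m" "f i = f j" for i j
  proof (cases "odd (j - i)")
    case True
    have "(f i, f j) \<in> ?E ^^ (j - i)"
      using walk_segment[OF f(2), of i j] that by auto
    then have "P (j - i)"
      using True that by (auto simp: P_def)
    then show False using least[of "j - i"] that by auto
  next
    case False
    have "(f 0, f i) \<in> ?E ^^ (i - 0)" "(f j, f m) \<in> ?E ^^ (m - j)"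
      using walk_segment[OF f(2), of 0 i] walk_segment[OF f(2), of j m] that by auto
    then have "(f 0, f 0) \<in> ?E ^^ (i + (m - j))"
      using that(3) f(1) by (metis diff_zero relpow_trans)
    moreover have "odd (i + (m - j))"
      using False that \<open>odd m\<close> by presburger
    ultimately have "P (i + (m - j))"
      by (auto simp: P_def)
    then show False using least[of "i + (m - j)"] that by auto
  qed
  then have inj: "inj_on f {0..<m}"
    by (intro inj_onI) (metis atLeastLessThan_iff linorder_neqE_nat)
  have "m \<noteq> 1"
    using f pair_no_loops by force
  then have "m \<ge> 3"
    using \<open>odd m\<close> by presburger
  then have "\<not> has_cycle_of_length G m"
    using assms(2,4) \<open>m \<le> l\<close> \<open>odd m\<close> by auto
  then show False
    using cycle_of_walk[OF assms(1) _ f(2,1) inj] \<open>m \<ge> 3\<close> by auto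
qed

section \<open>Shortest odd closed walks through a given vertex\<close>

text \<open>
  A connection of the same parity as the segment it replaces cannot be shorter; one of the other parity
  closes up to an odd closed walk with the segment, hence the bound \<open>2k + 3\<close>.
\<close>

definition taut_walk :: "nat \<Rightarrow> ('a \<times> 'a) set \<Rightarrow> nat \<Rightarrow> (nat \<Rightarrow> 'a) \<Rightarrow> bool" where
  "taut_walk k E L w \<longleftrightarrow> (\<forall>i j d. i \<le> j \<and> j \<le> L \<and> (w i, w j) \<in> E ^^ d \<longrightarrow>
    (if even (d + (j - i)) then j - i \<le> d else 2 * k + 3 \<le> d + (j - i)))"

lemma taut_walkD:
  assumes "taut_walk k E L w" "i \<le> j" "j \<le> L" "(w i, w j) \<in> E ^^ d"
  shows "if even (d + (j - i)) then j - i \<le> d else 2 * k + 3 \<le> d + (j - i)"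
  using assms unfolding taut_walk_def by blast

lemma taut_walk_mono:
  "taut_walk k E L w \<Longrightarrow> L' \<le> L \<Longrightarrow> taut_walk k E L' w"
  unfolding taut_walk_def by (meson order_trans)

text \<open>\<open>L\<close> is minimal only among odd closed walks through \<open>v\<close>.
  Replacing a segment by a connection of equal parity keeps \<open>v\<close> on the walk, so
  minimality applies; a connection of opposite parity may close up away from \<open>v\<close>, where
  only \<open>short\<close> helps.\<close>

lemma shortest_odd_closed_walk:
  assumes "sym E" and short: "\<forall>x l. odd l \<longrightarrow> l \<le> 2 * k + 1 \<longrightarrow> (x, x) \<notin> E ^^ l"
    and "odd l" "(v, v) \<in> E ^^ l"
  obtains w L where "w 0 = v" "odd L" "L \<ge> 2 * k + 3" "\<forall>i\<le>L. (w i, w i) \<in> E ^^ L"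
    and "taut_walk k E L w"
proof -
  define L where "L = (LEAST l. odd l \<and> (v, v) \<in> E ^^ l)"
  have L: "odd L" "(v, v) \<in> E ^^ L" and least: "\<And>l. odd l \<Longrightarrow> (v, v) \<in> E ^^ l \<Longrightarrow> L \<le> l"
    unfolding L_def using LeastI[of "\<lambda>l. odd l \<and> (v, v) \<in> E ^^ l" l] assms(3,4)
    by (auto intro: Least_le)
  then obtain w where w: "w 0 = v" "w L = v" "\<forall>i<L. (w i, w (Suc i)) \<in> E"
    unfolding relpow_fun_conv by auto
  have long: "2 * k + 3 \<le> l" if "odd l" "(x, x) \<in> E ^^ l" for x l
    proof -
    have "\<not> l \<le> 2 * k + 1" using short that by blast
    then show ?thesis using that(1) by presburger
  qed
  show thesis
  proof (rule that)
    show "w 0 = v" "odd L" "L \<ge> 2 * k + 3"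
      using w L long by auto
    have "(w i, w i) \<in> E ^^ L" if "i \<le> L" for i
      using walk_segment[OF w(3), of i L] walk_segment[OF w(3), of 0 i] that w
        relpow_trans[of "w i" v "L - i" E "w i" i] by auto
    then show "\<forall>i\<le>L. (w i, w i) \<in> E ^^ L" by blast
    have "if even (d + (j - i)) then j - i \<le> d else 2 * k + 3 \<le> d + (j - i)"
      if ij: "i \<le> j" "j \<le> L" "(w i, w j) \<in> E ^^ d" for i j d
    proof (cases "even (d + (j - i))")
      case True
      have "(v, w i) \<in> E ^^ i" "(w j, v) \<in> E ^^ (L - j)"
        using walk_segment[OF w(3), of 0 i] walk_segment[OF w(3), of j L] w ij by auto
      then have "(v, v) \<in> E ^^ (i + (d + (L - j)))"
        using ij by (meson relpow_trans)
      moreover have "odd (i + (d + (L - j)))"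
        using True ij L(1) by presburger
      ultimately have "L \<le> i + (d + (L - j))"
        by (rule least[rotated])
      then show ?thesis using True ij by auto
    next
      case False
      have "(w j, w i) \<in> E ^^ (j - i)"
        using walk_segment[OF w(3)] ij relpow_symD[OF assms(1)] by blast
      then have "(w i, w i) \<in> E ^^ (d + (j - i))"
        using ij by (meson relpow_trans)
      then show ?thesis using long False by auto
    qed
    then show "taut_walk k E L w"
      unfolding taut_walk_def by blast
  qed
qed

section \<open>Counting neighbours along a taut walk\<close>

text \<open>Above the least index \<open>a\<close> only \<open>a + 2\<close> and
  \<open>a + (2 * k + 1)\<close> are possible, and these exclude each other: their difference 2k - 1
  is odd and below 2k + 1.\<close>

lemma card_le_2_if_differences:
  fixes I :: "nat set"
  assumes "k \<ge> 2" "finite I" "\<And>i j. i \<in> I \<Longrightarrow> j \<in> I \<Longrightarrow> i < j \<Longrightarrow> j - i = 2 \<or> j - i = 2 * k + 1"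
  shows "card I \<le> 2"
proof (cases "I = {}")
  case False
  define a where "a = Min I"
  have a: "a \<in> I" "\<And>i. i \<in> I \<Longrightarrow> a \<le> i"
    using False assms(2) by (auto simp: a_def)
  have sub: "I \<subseteq> {a, a + 2, a + (2 * k + 1)}"
  proof
    fix i assume "i \<in> I"
    then show "i \<in> {a, a + 2, a + (2 * k + 1)}"
      using assms(3)[OF a(1), of i] a(2)[of i] by force
  qed
  have "\<not> (a + 2 \<in> I \<and> a + (2 * k + 1) \<in> I)"
    using assms(3)[of "a + 2" "a + (2 * k + 1)"] assms(1) by auto
  then have "I \<subseteq> {a, a + 2} \<or> I \<subseteq> {a, a + (2 * k + 1)}"
    using sub by auto
  then show ?thesis
    using card_mono[of "{a, a + 2}" I] card_mono[of "{a, a + (2 * k + 1)}" I] by auto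
qed simp

text \<open>Double counting of the pairs (i, u) with an arc from \<open>w i\<close> to
  \<open>u\<close>.\<close>

lemma sum_card_neighbours_le:
  assumes "finite V" "finite I" "\<And>u. u \<in> V \<Longrightarrow> card {i \<in> I. (w i, u) \<in> E} \<le> c"
    and "\<And>i. i \<in> I \<Longrightarrow> E `` {w i} \<subseteq> V"
  shows "(\<Sum>i\<in>I. card (E `` {w i})) \<le> c * card V"
proof -
  have "(\<Sum>i\<in>I. card (E `` {w i})) = (\<Sum>i\<in>I. \<Sum>u\<in>V. if (w i, u) \<in> E then 1 else 0)"
  proof (rule sum.cong[OF refl])
    fix i assume "i \<in> I"
    then have "E `` {w i} = {u \<in> V. (w i, u) \<in> E}"
      using assms(4) by auto
    then show "card (E `` {w i}) = (\<Sum>u\<in>V. if (w i, u) \<in> E then 1 else 0)"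
      using assms(1) by (simp add: sum.If_cases Int_def)
  qed
  also have "\<dots> = (\<Sum>u\<in>V. \<Sum>i\<in>I. if (w i, u) \<in> E then 1 else 0)"
    by (rule sum.swap)
  also have "\<dots> = (\<Sum>u\<in>V. card {i \<in> I. (w i, u) \<in> E})"
    using assms(2) by (simp add: sum.If_cases Int_def)
  also have "\<dots> \<le> (\<Sum>u\<in>V. c)"
    using assms(3) by (intro sum_mono)
  finally show ?thesis by (simp add: mult.commute)
qed

text \<open>\<open>V\<close> is any finite set containing the walk vertices and their
  neighbourhoods, so that the neighbourhood of a remote vertex can be removed from it
  beforehand.\<close>

lemma degree_sum_bounds:
  fixes w :: "nat \<Rightarrow> 'a"
  assumes "k \<ge> 2" "finite V" "sym E"
    and nbrs: "\<And>i. i \<le> 2 * k + 2 \<Longrightarrow> E `` {w i} \<subseteq> V"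
    and verts: "\<And>i. i \<le> 2 * k + 2 \<Longrightarrow> w i \<in> V"
    and taut: "taut_walk k E (2 * k + 2) w"
  shows "(\<Sum>i\<le>2 * k + 2. card (E `` {w i})) \<le> 2 * card V"
    and "(\<Sum>j\<le>k. card (E `` {w (j + 2 * (j div 2))})) + 1 \<le> card V"
proof -
  have common: "j - i = 2 \<or> j - i = 2 * k + 1"
    if "i < j" "j \<le> 2 * k + 2" "(w i, u) \<in> E" "(w j, u) \<in> E" for i j u
  proof -
    \<comment> \<open>A common neighbour is a connection of length 2: an even \<open>j - i\<close>
      is at most 2, an odd one at least 2k + 1.\<close>
    have "(w i, w j) \<in> E ^^ 2"
      using that assms(3) by (auto simp: numeral_2_eq_2 dest: symD)
    from taut_walkD[OF taut _ _ this] that show ?thesis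
      by (auto split: if_splits) presburger+
  qed
  show "(\<Sum>i\<le>2 * k + 2. card (E `` {w i})) \<le> 2 * card V"
  proof (rule sum_card_neighbours_le)
    show "card {i \<in> {..2 * k + 2}. (w i, u) \<in> E} \<le> 2" for u
      by (rule card_le_2_if_differences[OF assms(1)]) (use common in auto)
  qed (use assms in auto)
  \<comment> \<open>The indices 0, 1, 4, 5, 8, ... are those congruent to 0 or 1 modulo 4. Two of
    them never differ by 2, and up to \<open>s k\<close> \<le> 2k never by 2k + 1.\<close>
  define s where "s j = j + 2 * (j div 2)" for j :: nat
  have s_le: "s j \<le> 2 * k" if "j \<le> k" for j
    using that unfolding s_def by presburger
  have s_diff: "s i < s j \<and> s j - s i \<noteq> 2" if "i < j" for i j
  proof (cases "i div 2 = j div 2")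
    case True
    then have "j = Suc i" using that by presburger
    then show ?thesis using True by (simp add: s_def)
  next
    case False
    then have "i div 2 < j div 2" using that div_le_mono[of i j 2] by linarith
    then show ?thesis using that unfolding s_def by linarith
  qed
  define N where "N j = E `` {w (s j)}" for j
  have disj: "N i \<inter> N j = {}" if "i < j" "j \<le> k" for i j
  proof (rule ccontr)
    assume "N i \<inter> N j \<noteq> {}"
    then obtain u where "(w (s i), u) \<in> E" "(w (s j), u) \<in> E"
      by (auto simp: N_def)
    with common[of "s i" "s j" u] s_diff[OF that(1)] s_le[OF that(2)] show False
      by auto
  qed
  \<comment> \<open>\<open>p\<close> is 0 or 3 modulo 4, hence never the successor of some
    \<open>s j\<close>. Tautness permits an edge from \<open>w (s j)\<close> to \<open>w p\<close>
    only if \<open>p\<close> is that successor or at least 2k + 2 further on.\<close>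
  define p where "p = (if even k then 2 * k else 2 * k + 1)"
  have p_s: "p \<noteq> Suc (s j)" "s j \<le> p" "p \<le> 2 * k + 1" "\<not> (s j = 0 \<and> p = 2 * k + 2)" if "j \<le> k" for j
    using that unfolding p_def s_def by (simp_all split: if_splits) presburger+
  have uncovered: "w p \<notin> N j" if "j \<le> k" for j
  proof
    assume "w p \<in> N j"
    then have "(w (s j), w p) \<in> E ^^ 1"
      by (simp add: N_def)
    from taut_walkD[OF taut p_s(2)[OF that] _ this] p_s[OF that] show False
      by (cases "p = s j") (auto split: if_splits)
  qed
  have N_sub: "N j \<subseteq> V" if "j \<le> k" for j
    using nbrs[of "s j"] s_le[OF that] by (simp add: N_def)
  have "(\<Sum>j\<le>k. card (N j)) = card (\<Union>j\<le>k. N j)"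
  proof (rule card_UN_disjoint[symmetric])
    show "\<forall>j\<in>{..k}. finite (N j)"
      using finite_subset[OF N_sub assms(2)] by auto
    show "\<forall>i\<in>{..k}. \<forall>j\<in>{..k}. i \<noteq> j \<longrightarrow> N i \<inter> N j = {}"
      using disj by (metis Int_commute atMost_iff linorder_neqE_nat)
  qed simp
  moreover have "card (insert (w p) (\<Union>j\<le>k. N j)) \<le> card V"
    using assms(2) N_sub verts[of p] p_s(3)[of 0] by (intro card_mono) auto
  moreover have "card (insert (w p) (\<Union>j\<le>k. N j)) = card (\<Union>j\<le>k. N j) + 1"
    using uncovered finite_subset[OF N_sub assms(2)] by (subst card_insert_disjoint) auto
  ultimately show "(\<Sum>j\<le>k. card (E `` {w (j + 2 * (j div 2))})) + 1 \<le> card V"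
    by (simp add: N_def s_def)
qed

section \<open>The two degree bounds and the theorem\<close>

text \<open>If \<open>v\<close> lies on an odd closed walk, its degree is the term of index 0 in
  both sums; otherwise its neighbourhood is set aside and the sums are bounded in the rest of
  \<open>V\<close>.\<close>

lemma non_bipartite_degree_bounds:
  assumes "k \<ge> 2" "finite V" "sym E" "E \<subseteq> V \<times> V" "v \<in> V"
    and short: "\<forall>x l. odd l \<longrightarrow> l \<le> 2 * k + 1 \<longrightarrow> (x, x) \<notin> E ^^ l"
    and odd_walk: "odd l" "(x, x) \<in> E ^^ l"
    and min: "\<forall>y\<in>V. \<delta> \<le> card (E `` {y})"
  shows "card (E `` {v}) + (2 * k + 2) * \<delta> \<le> 2 * card V"
    and "card (E `` {v}) + k * \<delta> + 1 \<le> card V"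
proof -
  let ?d = "\<lambda>y. card (E `` {y})"
  have on_walk_in_V: "y \<in> V" if "(y, y) \<in> E ^^ L" "odd L" for y L
  proof -
    \<comment> \<open>Positive length gives a last arc, which ends in \<open>V\<close>; a walk of
      length 0 would say nothing.\<close>
    obtain L' where "L = Suc L'" using \<open>odd L\<close> by (cases L) auto
    then show ?thesis using that(1) assms(4) by (blast elim: relpow_Suc_E)
  qed
  have "?d v + (2 * k + 2) * \<delta> \<le> 2 * card V \<and> ?d v + k * \<delta> + 1 \<le> card V"
  proof (cases "\<exists>l. odd l \<and> (v, v) \<in> E ^^ l")
    case True
    then obtain l where l: "odd l" "(v, v) \<in> E ^^ l" by auto
    obtain w L
      where w: "w 0 = v" "odd L" "L \<ge> 2 * k + 3" "\<forall>i\<le>L. (w i, w i) \<in> E ^^ L"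
        and taut: "taut_walk k E L w"
      by (rule shortest_odd_closed_walk[OF assms(3) short l])
    have V: "w i \<in> V" if "i \<le> 2 * k + 2" for i
      using on_walk_in_V[OF _ w(2)] that w(3,4) by auto
    have bounds: "(\<Sum>i\<le>2 * k + 2. ?d (w i)) \<le> 2 * card V"
        "(\<Sum>j\<le>k. ?d (w (j + 2 * (j div 2)))) + 1 \<le> card V"
      by (rule degree_sum_bounds[OF assms(1-3)]; use assms(4) V w(3) taut_walk_mono[OF taut] in auto)+
    have "?d v + (\<Sum>i<2 * k + 2. \<delta>) \<le> ?d v + (\<Sum>i<2 * k + 2. ?d (w (Suc i)))"
      using V min by (intro add_left_mono sum_mono) auto
    also have "\<dots> = (\<Sum>i\<le>2 * k + 2. ?d (w i))"
      using w(1) by (subst sum.atMost_shift) simp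
    finally have A: "?d v + (2 * k + 2) * \<delta> \<le> 2 * card V"
      using bounds(1) by simp
    have "w (Suc j + 2 * (Suc j div 2)) \<in> V" if "j < k" for j
      using that by (intro V) presburger
    then have "?d v + (\<Sum>j<k. \<delta>) \<le> ?d v + (\<Sum>j<k. ?d (w (Suc j + 2 * (Suc j div 2))))"
      using min by (intro add_left_mono sum_mono) auto
    also have "\<dots> = (\<Sum>j\<le>k. ?d (w (j + 2 * (j div 2))))"
      using w(1) by (subst sum.atMost_shift) simp
    finally have "?d v + k * \<delta> + 1 \<le> card V"
      using bounds(2) by simp
    with A show ?thesis by simp
  next
    case False
    obtain w L
      where w: "odd L" "L \<ge> 2 * k + 3" "\<forall>i\<le>L. (w i, w i) \<in> E ^^ L"
        and taut: "taut_walk k E L w"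
      by (rule shortest_odd_closed_walk[OF assms(3) short odd_walk])
    have unreach: "(v, w i) \<notin> E ^^ d" if "i \<le> L" for i d
    proof
      assume "(v, w i) \<in> E ^^ d"
      \<comment> \<open>Go to \<open>w i\<close>, once around its odd closed walk, and back: the
        length 2d + L is odd.\<close>
      then have "(v, v) \<in> E ^^ (d + (L + d))"
        using w(3) that relpow_symD[OF assms(3)] by (meson relpow_trans)
      then show False using False w(1) by (metis even_add)
    qed
    define V' where "V' = V - E `` {v}"
    have V': "w i \<in> V'" if "i \<le> L" for i
      using on_walk_in_V[OF _ w(1)] w(3) that unreach[OF that, of 1] by (auto simp: V'_def)
    have nbrs: "E `` {w i} \<subseteq> V'" if "i \<le> L" for i
    proof -
      have "(v, u) \<notin> E" if "(w i, u) \<in> E" for u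
        using unreach[OF \<open>i \<le> L\<close>, of 2] that assms(3) by (auto simp: numeral_2_eq_2 dest: symD)
      then show ?thesis using assms(4) by (auto simp: V'_def)
    qed
    have fin: "finite V'" using assms(2) by (simp add: V'_def)
    have bounds: "(\<Sum>i\<le>2 * k + 2. ?d (w i)) \<le> 2 * card V'"
        "(\<Sum>j\<le>k. ?d (w (j + 2 * (j div 2)))) + 1 \<le> card V'"
      by (rule degree_sum_bounds[OF assms(1) fin assms(3)]; use nbrs V' w(2) taut_walk_mono[OF taut] in auto)+
    have V: "w i \<in> V" if "i \<le> L" for i
      using V'[OF that] by (simp add: V'_def)
    have "card V' + ?d v = card V"
      using assms(2,4) by (subst card_Un_disjoint[symmetric])
        (auto simp: V'_def intro: finite_subset[of _ V] arg_cong[where f = card])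
    moreover have "(\<Sum>i\<le>2 * k + 2. \<delta>) \<le> (\<Sum>i\<le>2 * k + 2. ?d (w i))"
      using V w(2) min by (intro sum_mono) auto
    moreover have "w (j + 2 * (j div 2)) \<in> V" if "j \<le> k" for j
      using that w(2) by (intro V) presburger
    then have "(\<Sum>j\<le>k. \<delta>) \<le> (\<Sum>j\<le>k. ?d (w (j + 2 * (j div 2))))"
      using min by (intro sum_mono) auto
    \<comment> \<open>Here \<open>v\<close> is not among the summands, so the sums yield (2k + 3)
      \<delta> and (k + 1) \<delta>, which is more than required.\<close>
    ultimately show ?thesis using bounds by simp
  qed
  then show "?d v + (2 * k + 2) * \<delta> \<le> 2 * card V" "?d v + k * \<delta> + 1 \<le> card V"
    by auto
qed

lemma out_degree_eq_card_Image:
  "out_degree (with_proj G) v = card (parcs G `` {v})"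
proof -
  have "out_arcs (with_proj G) v = Pair v ` (parcs G `` {v})"
    by (auto simp: out_arcs_def)
  then show ?thesis
    by (simp add: out_degree_def card_image inj_on_def)
qed

theorem theorem1p4:
  fixes G :: "'a pair_pre_digraph" and k n :: nat
  assumes "k \<ge> 2"
    and "pair_graph G"
    and "card (pverts G) = n"
    and "\<forall>l \<in> {3..2 * k + 1}. odd l \<longrightarrow> \<not> has_cycle_of_length G l"
    and "real (min_degree G) >
      min (real n / (real k + 1) - real (max_degree G) / (2 * real k + 2))
          ((real n - 1 - real (max_degree G)) / real k)"
  shows "bipartite G"
proof (rule ccontr)
  assume "\<not> bipartite G"
  interpret pair_graph G by fact
  let ?E = "parcs G" and ?V = "pverts G"
  have sy: "sym ?E"
    using pair_sym_arcs by (auto simp: symmetric_def)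
  have EV: "?E \<subseteq> ?V \<times> ?V"
    using in_arcsD1 in_arcsD2 by auto
  obtain x l where xl: "odd l" "(x, x) \<in> ?E ^^ l"
    using odd_closed_walk_if_not_bipartite[OF assms(2) \<open>\<not> bipartite G\<close>] by blast
  \<comment> \<open>The empty graph is bipartite, so \<open>Max\<close> ranges over a nonempty
    set.\<close>
  have "?V \<noteq> {}"
    using \<open>\<not> bipartite G\<close> EV by (auto simp: bipartite_def)
  then have "max_degree G \<in> out_degree (with_proj G) ` ?V"
    unfolding max_degree_def using pair_finite_verts by (intro Max_in) auto
  then obtain v where v: "v \<in> ?V" "max_degree G = card (?E `` {v})"
    by (auto simp: out_degree_eq_card_Image)
  have min: "\<forall>y\<in>?V. min_degree G \<le> card (?E `` {y})"
    using pair_finite_verts by (auto simp: min_degree_def out_degree_eq_card_Image)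
  have short: "\<forall>x l. odd l \<longrightarrow> l \<le> 2 * k + 1 \<longrightarrow> (x, x) \<notin> ?E ^^ l"
    using no_short_odd_closed_walk[OF assms(2,4)] by blast
  note bounds = non_bipartite_degree_bounds[OF assms(1) pair_finite_verts sy EV v(1)
      short xl min, folded v(2), unfolded assms(3)]
  have "real (max_degree G + (2 * k + 2) * min_degree G) \<le> real (2 * n)"
    "real (max_degree G + k * min_degree G + 1) \<le> real n"
    using bounds by (simp_all only: of_nat_le_iff)
  then have "real (max_degree G) + (2 * real k + 2) * real (min_degree G) \<le> 2 * real n"
    and B: "real (min_degree G) * real k \<le> real n - 1 - real (max_degree G)"
    by (simp_all add: algebra_simps)
  then have "real (min_degree G) \<le> (2 * real n - real (max_degree G)) / (2 * real k + 2)"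
    by (simp add: pos_le_divide_eq mult.commute)
  also have "\<dots> = real n / (real k + 1) - real (max_degree G) / (2 * real k + 2)"
    by (simp add: diff_divide_distrib mult_divide_mult_cancel_left[of 2 "real n" "real k + 1", simplified])
  finally have "real (min_degree G) \<le> real n / (real k + 1) - real (max_degree G) / (2 * real k + 2)" .
  moreover have "real (min_degree G) \<le> (real n - 1 - real (max_degree G)) / real k"
    using B assms(1) by (simp add: pos_le_divide_eq)
  \<comment> \<open>Exceeding the minimum means exceeding one of its two terms, so both upper bounds
    are used.\<close>
  ultimately show False using assms(5) by auto
qed

end
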